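(* Let $L$ be a complete modular lattice. If $x\prec y$ is a covering which is regular in $L$, then $\mu[\mathrm{Fg}\{x\}\prec\mathrm{Fg}\{y\}]=\mu[x\prec y]$, where the left side is the multiplicity in $\mathrm{Fil}\,L$ and the right side is the multiplicity in $L$.
   Context: A covering $x\prec y$ in a lattice is a pair $x<y$ with no element strictly between. For pairs with $x\le y$, $z\le w$, write $\langle x,y\rangle\nearrow\langle z,w\rangle$ if $y\wedge z=x$ and $y\vee z=w$; projective equivalence $\sim$ is the symmetric and transitive closure of $\nearrow$. For a chain $C$ in a modular lattice $M$ and a covering $x\prec y$ of $M$, the $C$-multiplicity $\mu_C[x\prec y]$ is the cardinality of the set of coverings $u\prec v$ of $M$ with $u,v\in C$ and $\langle u,v\rangle\sim\langle x,y\rangle$. The covering is weakly regular if $\mu_C[x\prec y]$ is the same cardinal for all maximal chains $C$ of $M$; that common cardinal is the multiplicity $\mu[x\prec y]$ of $x\prec y$ in $M$. A covering $x\prec y$ in a complete modular lattice is upper regular if for every nonempty chain $I$ and every family of coverings $x_i\prec y_i$ ($i\in I$), each projectively equivalent to $x\prec y$ and such that $i<j$ implies $\langle x_i,y_i\rangle\nearrow\langle x_j,y_j\rangle$, we have $\bigvee_i x_i\prec\bigvee_i y_i$. Lower regular is the dual property; regular means both. It is known (previous work) that a regular covering in a complete modular lattice is weakly regular. A filter of $L$ is a nonempty up-closed subset closed under binary meets. $\mathrm{Fil}\,L$ is the lattice of filters ordered by reverse inclusion ($F\le G$ iff $G\subseteq F$); it is complete and modular when $L$ is. $\mathrm{Fg}\{x\}=\{z\in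 L: z\ge x\}$; $x\prec y$ in $L$ implies $\mathrm{Fg}\{x\}\prec\mathrm{Fg}\{y\}$ in $\mathrm{Fil}\,L$. *)

theory Defs
  imports Main
begin

unbundle cardinal_syntax

class modular_lattice = lattice +
  assumes modular: "x \<le> z \<Longrightarrow> sup x (inf y z) = inf (sup x y) z"

section \<open>Coverings and projectivity\<close>

definition covered_by :: "'a::order \<Rightarrow> 'a \<Rightarrow> bool" where
  "covered_by x y \<longleftrightarrow> x < y \<and> \<not> (\<exists>z. x < z \<and> z < y)"

definition transposes_up :: "'a::lattice \<times> 'a \<Rightarrow> 'a \<times> 'a \<Rightarrow> bool" where
  "transposes_up p q \<longleftrightarrow>
     fst p \<le> snd p \<and> fst q \<le> snd q \<and> inf (snd p) (fst q) = fst p \<and> sup (snd p) (fst q) = snd q"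

definition projective :: "'a::lattice \<times> 'a \<Rightarrow> 'a \<times> 'a \<Rightarrow> bool" where
  "projective = (symclp transposes_up)\<^sup>+\<^sup>+"

section \<open>Multiplicity\<close>

abbreviation maximal_chain :: "'a::order set \<Rightarrow> bool" where
  "maximal_chain \<equiv> pred_on.maxchain UNIV (<)"

text \<open>The coverings counted below are coverings of the whole lattice whose two ends lie in
  \<open>C\<close>, not merely consecutive elements of \<open>C\<close>.  Cardinals are represented by
  cardinal well-orders, compared by \<open>=o\<close>.\<close>

definition chain_multiplicity :: "'a::lattice set \<Rightarrow> 'a \<Rightarrow> 'a \<Rightarrow> ('a \<times> 'a) rel" where
  "chain_multiplicity C x y =
     |{(u, v). u \<in> C \<and> v \<in> C \<and> covered_by u v \<and> projective (u, v) (x, y)}|"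

definition weakly_regular :: "'a::lattice \<Rightarrow> 'a \<Rightarrow> bool" where
  "weakly_regular x y \<longleftrightarrow> covered_by x y \<and>
     (\<forall>C D. maximal_chain C \<longrightarrow> maximal_chain D \<longrightarrow>
        chain_multiplicity C x y =o chain_multiplicity D x y)"

text \<open>Only meaningful for weakly regular coverings, where the choice of the maximal chain
  (one exists by Hausdorff's maximal principle) does not matter up to \<open>=o\<close>.\<close>

definition cover_multiplicity :: "'a::lattice \<Rightarrow> 'a \<Rightarrow> ('a \<times> 'a) rel" where
  "cover_multiplicity x y = chain_multiplicity (SOME C. maximal_chain C) x y"

section \<open>Regular coverings\<close>

text \<open>Families of coverings are indexed by arbitrary linearly ordered nonempty sets
  \<open>(I, r)\<close>, with \<open>r\<close> the non-strict order.  Taking the index type to be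
  \<open>'a \<times> 'a\<close> is no restriction: repeated members of a family contribute nothing, so the
  family can be indexed by the pairs \<open>(x\<^sub>i, y\<^sub>i)\<close> themselves, on which
  \<open>transposes_up\<close> is antisymmetric.\<close>

definition upper_regular :: "'a::complete_lattice \<Rightarrow> 'a \<Rightarrow> bool" where
  "upper_regular x y \<longleftrightarrow> covered_by x y \<and>
     (\<forall>(I :: ('a \<times> 'a) set) r X Y.
        I \<noteq> {} \<longrightarrow> linear_order_on I r \<longrightarrow>
        (\<forall>i\<in>I. covered_by (X i) (Y i) \<and> projective (X i, Y i) (x, y)) \<longrightarrow>
        (\<forall>i\<in>I. \<forall>j\<in>I. (i, j) \<in> r \<longrightarrow> i \<noteq> j \<longrightarrow> transposes_up (X i, Y i) (X j, Y j)) \<longrightarrow>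
        covered_by (SUP i\<in>I. X i) (SUP i\<in>I. Y i))"

text \<open>In the dual lattice the pair of a covering \<open>(x, y)\<close> is \<open>(y, x)\<close>, and
  \<open>(y\<^sub>i, x\<^sub>i)\<close> transposes up to \<open>(y\<^sub>j, x\<^sub>j)\<close> there iff
  \<open>(x\<^sub>j, y\<^sub>j)\<close> transposes up to \<open>(x\<^sub>i, y\<^sub>i)\<close> here.\<close>

definition lower_regular :: "'a::complete_lattice \<Rightarrow> 'a \<Rightarrow> bool" where
  "lower_regular x y \<longleftrightarrow> covered_by x y \<and>
     (\<forall>(I :: ('a \<times> 'a) set) r X Y.
        I \<noteq> {} \<longrightarrow> linear_order_on I r \<longrightarrow>
        (\<forall>i\<in>I. covered_by (X i) (Y i) \<and> projective (X i, Y i) (x, y)) \<longrightarrow>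
        (\<forall>i\<in>I. \<forall>j\<in>I. (i, j) \<in> r \<longrightarrow> i \<noteq> j \<longrightarrow> transposes_up (X j, Y j) (X i, Y i)) \<longrightarrow>
        covered_by (INF i\<in>I. X i) (INF i\<in>I. Y i))"

definition regular :: "'a::complete_lattice \<Rightarrow> 'a \<Rightarrow> bool" where
  "regular x y \<longleftrightarrow> upper_regular x y \<and> lower_regular x y"

section \<open>The lattice of filters\<close>

definition is_lattice_filter :: "'a::lattice set \<Rightarrow> bool" where
  "is_lattice_filter F \<longleftrightarrow>
     F \<noteq> {} \<and> (\<forall>a b. a \<in> F \<longrightarrow> a \<le> b \<longrightarrow> b \<in> F) \<and> (\<forall>a\<in>F. \<forall>b\<in>F. inf a b \<in> F)"

typedef (overloaded) 'a lattice_filter = "{F :: 'a::lattice set. is_lattice_filter F}"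
  morphisms filter_set Abs_lattice_filter
  by (rule exI[of _ UNIV]) (simp add: is_lattice_filter_def)

setup_lifting type_definition_lattice_filter

lift_definition Fg :: "'a::lattice \<Rightarrow> 'a lattice_filter" is "\<lambda>x. {z. x \<le> z}"
  by (auto simp: is_lattice_filter_def intro: order_trans)

text \<open>The order is reverse inclusion; the remaining operations are determined by it, as the
  instance proofs show.\<close>

instantiation lattice_filter :: (lattice) lattice
begin

lift_definition less_eq_lattice_filter :: "'a lattice_filter \<Rightarrow> 'a lattice_filter \<Rightarrow> bool"
  is "\<lambda>F G. G \<subseteq> F" .

lift_definition less_lattice_filter :: "'a lattice_filter \<Rightarrow> 'a lattice_filter \<Rightarrow> bool"
  is "\<lambda>F G. G \<subset> F" .

lift_definition sup_lattice_filter ::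
    "'a lattice_filter \<Rightarrow> 'a lattice_filter \<Rightarrow> 'a lattice_filter"
  is "\<lambda>F G. F \<inter> G"
proof -
  fix F G :: "'a set"
  assume F: "is_lattice_filter F" and G: "is_lattice_filter G"
  then obtain a b where "a \<in> F" "b \<in> G" by (auto simp: is_lattice_filter_def)
  then have "sup a b \<in> F \<inter> G"
    using F G sup_ge1[of a b] sup_ge2[of b a] unfolding is_lattice_filter_def by blast
  then show "is_lattice_filter (F \<inter> G)"
    using F G unfolding is_lattice_filter_def by blast
qed

lift_definition inf_lattice_filter ::
    "'a lattice_filter \<Rightarrow> 'a lattice_filter \<Rightarrow> 'a lattice_filter"
  is "\<lambda>F G. {z. \<exists>a\<in>F. \<exists>b\<in>G. inf a b \<le> z}"
proof -
  fix F G :: "'a set"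
  assume F: "is_lattice_filter F" and G: "is_lattice_filter G"
  let ?H = "{z. \<exists>a\<in>F. \<exists>b\<in>G. inf a b \<le> z}"
  have "inf z w \<in> ?H" if "z \<in> ?H" "w \<in> ?H" for z w
  proof -
    from that obtain a b c d where *: "a \<in> F" "b \<in> G" "inf a b \<le> z"
      "c \<in> F" "d \<in> G" "inf c d \<le> w"
      by blast
    have "inf (inf a c) (inf b d) \<le> inf z w"
      using inf_mono[OF *(3,6)] by (simp add: inf_assoc inf_left_commute)
    moreover have "inf a c \<in> F" "inf b d \<in> G"
      using F G * by (auto simp: is_lattice_filter_def)
    ultimately show ?thesis by blast
  qed
  moreover have "?H \<noteq> {}"
    using F G order_refl unfolding is_lattice_filter_def by blast
  moreover have "w \<in> ?H" if "z \<in> ?H" "z \<le> w" for z w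
    using that by (blast intro: order_trans)
  ultimately show "is_lattice_filter ?H"
    unfolding is_lattice_filter_def[of ?H] by simp
qed

instance
proof
  fix F G H :: "'a lattice_filter"
  show "F < G \<longleftrightarrow> F \<le> G \<and> \<not> G \<le> F" by transfer auto
  show "F \<le> F" by transfer auto
  show "F \<le> G \<Longrightarrow> G \<le> H \<Longrightarrow> F \<le> H" by transfer auto
  show "F \<le> G \<Longrightarrow> G \<le> F \<Longrightarrow> F = G" by transfer auto
  show "F \<le> sup F G" "G \<le> sup F G" by (transfer, auto)+
  show "G \<le> F \<Longrightarrow> H \<le> F \<Longrightarrow> sup G H \<le> F" by transfer auto
  have witness: "\<exists>a. a \<in> A" if "is_lattice_filter A" for A :: "'a set"
    using that by (auto simp: is_lattice_filter_def)
  show "inf F G \<le> F"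
    by transfer (use witness in \<open>blast intro: inf_le1\<close>)
  show "inf F G \<le> G"
    by transfer (use witness in \<open>blast intro: inf_le2\<close>)
  have "z \<in> A" if "is_lattice_filter A" "a \<in> A" "b \<in> A" "inf a b \<le> z" for A and a b z :: 'a
    using that unfolding is_lattice_filter_def by blast
  then show "F \<le> G \<Longrightarrow> F \<le> H \<Longrightarrow> F \<le> inf G H"
    by transfer blast
qed

end

instantiation lattice_filter :: (bounded_lattice_top) complete_lattice
begin

lift_definition bot_lattice_filter :: "'a lattice_filter" is UNIV
  by (simp add: is_lattice_filter_def)

lift_definition top_lattice_filter :: "'a lattice_filter" is "{top}"
  by (auto simp: is_lattice_filter_def top_unique)

lift_definition Sup_lattice_filter :: "'a lattice_filter set \<Rightarrow> 'a lattice_filter"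
  is "\<lambda>\<F>. \<Inter>\<F>"
proof -
  fix \<F> :: "'a set set"
  assume *: "\<And>F. F \<in> \<F> \<Longrightarrow> is_lattice_filter F"
  have "top \<in> F" if "F \<in> \<F>" for F
    using *[OF that] unfolding is_lattice_filter_def by (metis equals0I top_greatest)
  then have "\<Inter>\<F> \<noteq> {}" by blast
  with * show "is_lattice_filter (\<Inter>\<F>)"
    unfolding is_lattice_filter_def by blast
qed

definition Inf_lattice_filter :: "'a lattice_filter set \<Rightarrow> 'a lattice_filter" where
  "Inf_lattice_filter \<F> = Sup {G. \<forall>F\<in>\<F>. G \<le> F}"

instance
proof
  fix F :: "'a lattice_filter" and \<F> :: "'a lattice_filter set"
  have upper: "F \<le> Sup \<F>" if "F \<in> \<F>" for F :: "'a lattice_filter" and \<F>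
    using that by transfer auto
  have least: "Sup \<F> \<le> H" if "\<And>F. F \<in> \<F> \<Longrightarrow> F \<le> H" for H :: "'a lattice_filter" and \<F>
    using that by transfer auto
  show "F \<in> \<F> \<Longrightarrow> F \<le> Sup \<F>" by (rule upper)
  show "(\<And>G. G \<in> \<F> \<Longrightarrow> G \<le> F) \<Longrightarrow> Sup \<F> \<le> F" by (rule least)
  show "F \<in> \<F> \<Longrightarrow> Inf \<F> \<le> F"
    unfolding Inf_lattice_filter_def by (rule least) blast
  show "(\<And>G. G \<in> \<F> \<Longrightarrow> F \<le> G) \<Longrightarrow> F \<le> Inf \<F>"
    unfolding Inf_lattice_filter_def by (rule upper) blast
  show "Inf {} = (top :: 'a lattice_filter)"
  proof (rule antisym)
    show "Inf {} \<le> (top :: 'a lattice_filter)"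
      unfolding Inf_lattice_filter_def
      by (rule least, transfer) (metis all_not_in_conv empty_subsetI insert_subset
          is_lattice_filter_def top_greatest)
    show "top \<le> (Inf {} :: 'a lattice_filter)"
      unfolding Inf_lattice_filter_def by (rule upper) blast
  qed
  show "Sup {} = (bot :: 'a lattice_filter)"
    by transfer simp
qed

end

instance lattice_filter :: (modular_lattice) modular_lattice
proof
  fix F G H :: "'a lattice_filter"
  assume FH: "F \<le> H"
  show "sup F (inf G H) = inf (sup F G) H"
  proof (rule antisym)
    show "sup F (inf G H) \<le> inf (sup F G) H"
      using FH by (simp add: le_infI1 le_infI2)
    have "\<exists>c\<in>F \<inter> G. \<exists>d\<in>H. inf c d \<le> z"
      if F: "is_lattice_filter F" and G: "is_lattice_filter G" and H: "is_lattice_filter H"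
        and HF: "H \<subseteq> F" and z: "z \<in> F" and ab: "a \<in> G" "b \<in> H" "inf a b \<le> z"
      for F G H :: "'a set" and a b z
    proof -
      let ?x = "inf z b"
      have "?x \<in> F" using F HF z ab by (auto simp: is_lattice_filter_def)
      then have "sup ?x a \<in> F \<inter> G"
        using F G ab unfolding is_lattice_filter_def by (meson IntI sup_ge1 sup_ge2)
      moreover have "inf (sup ?x a) b = sup ?x (inf a b)"
        using modular[of ?x b a] by simp
      then have "inf (sup ?x a) b \<le> z"
        using ab by (simp add: le_infI1)
      ultimately show ?thesis using ab by blast
    qed
    then show "inf (sup F G) H \<le> sup F (inf G H)"
      using FH by transfer blast
  qed
qed

end

theory Submission
  imports Defs
begin

text \<open>
  Coverings \<open>(u, v)\<close> and \<open>(p, q)\<close> of two chains are matched if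
  \<open>inf v p \<le> u\<close>, \<open>inf q u \<le> p\<close> and \<open>\<not> inf v q \<le> u\<close>, as in the Jordan--Hoelder theorem.
  Matched coverings are projective, and a covering has at most one match in a given chain, so only
  the existence of matches is at stake.  In a maximal chain \<open>D\<close> the match of \<open>(u, v)\<close>
  is the pair of the supremum of those \<open>d \<in> D\<close> with \<open>inf v d \<le> u\<close> and the infimum
  of the others.  Upper and lower regularity say that these bounds stay on their sides, and lower
  regularity extends from chains to downward directed sets.

  A maximal chain \<open>C\<close> of filters is matched with the principal filters of a maximal chain
  \<open>D\<close> of the lattice.  A filter covering \<open>(U, V)\<close> projective to \<open>(Fg x, Fg y)\<close> transposes
  up to a principal one \<open>(Fg a, Fg b)\<close>; by lower regularity \<open>(inf a (Inf V), Inf V)\<close> is again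
  a covering, and it has the same match in \<open>D\<close> as \<open>(U, V)\<close>.  The delicate point is
  to match \<open>(Fg p, Fg q)\<close> in \<open>C\<close>: given filters in \<open>C\<close> that each have a member \<open>w\<close>
  with \<open>inf q w \<le> p\<close>, one needs a common member with this property, and a suitable maximal
  one will do.
\<close>

section \<open>Coverings in modular lattices\<close>

lemma modular_inf_sup:
  fixes x y z :: "'a::modular_lattice"
  assumes "x \<le> z"
  shows "inf z (sup x y) = sup x (inf z y)"
  using modular[OF assms, of y] by (simp add: inf_commute)

lemma covered_byD: "covered_by x y \<Longrightarrow> x \<le> z \<Longrightarrow> z \<le> y \<Longrightarrow> z = x \<or> z = y"
  unfolding covered_by_def by (metis order_le_imp_less_or_eq)

lemma covered_by_less: "covered_by x y \<Longrightarrow> x < y"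
  by (simp add: covered_by_def)

lemma covered_by_le: "covered_by x y \<Longrightarrow> x \<le> y"
  by (simp add: covered_by_def less_imp_le)

lemma covered_by_sup_eq:
  fixes p q :: "'a::lattice"
  assumes "covered_by p q" "z \<le> q" "\<not> z \<le> p"
  shows "sup p z = q"
proof -
  have "sup p z = p \<or> sup p z = q"
    using assms covered_by_le by (intro covered_byD) auto
  moreover have "sup p z \<noteq> p" using assms(3) sup_ge2[of z p] by metis
  ultimately show ?thesis by blast
qed

lemma covered_by_inf_le:
  fixes p q :: "'a::lattice"
  assumes "covered_by p q" "p \<le> z" "\<not> q \<le> z"
  shows "inf q z = p"
proof -
  have "inf q z = p \<or> inf q z = q"
    using assms covered_by_le by (intro covered_byD) auto
  moreover have "inf q z \<noteq> q" using assms(3) inf_le2[of q z] by metis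
  ultimately show ?thesis by blast
qed

lemma transposes_up_pair:
  "transposes_up (a, b) (c, d) \<longleftrightarrow> a \<le> b \<and> c \<le> d \<and> inf b c = a \<and> sup b c = d"
  by (simp add: transposes_up_def)

lemma transposes_up_trans:
  assumes "transposes_up p q" "transposes_up q r"
  shows "transposes_up p r"
proof -
  have "inf (snd p) (fst r) = inf (snd p) (inf (snd q) (fst r))"
    using assms unfolding transposes_up_def by (metis inf.assoc inf_sup_absorb)
  moreover have "sup (snd p) (fst r) = sup (sup (snd p) (fst q)) (fst r)"
    using assms unfolding transposes_up_def by (metis sup.assoc sup_inf_absorb sup_commute inf_commute)
  ultimately show ?thesis using assms unfolding transposes_up_def by metis
qed

text \<open>The interval from \<open>a\<close> to \<open>b\<close> is isomorphic to the one from
  \<open>c\<close> to \<open>d\<close> via \<open>sup c\<close> and \<open>inf b\<close>; modularity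
  makes these two maps inverse to each other.\<close>

lemma transposes_up_covered_by:
  fixes a b c d :: "'a::modular_lattice"
  assumes t: "transposes_up (a, b) (c, d)"
  shows "covered_by a b \<longleftrightarrow> covered_by c d"
proof -
  have ab: "a \<le> b" "c \<le> d" "inf b c = a" "sup b c = d"
    using t by (auto simp: transposes_up_pair)
  have up: "z = c \<or> z = d" if cov: "covered_by a b" and z: "c \<le> z" "z \<le> d" for z
  proof -
    have "inf b z = a \<or> inf b z = b"
      using z ab by (intro covered_byD[OF cov]) (auto intro: le_infI2)
    moreover have "z = sup c (inf b z)"
      using modular[of c z b] z ab by (simp add: sup_commute inf_absorb2)
    ultimately show ?thesis using ab by (metis sup_commute sup_inf_absorb inf_commute)
  qed
  have down: "z = a \<or> z = b" if cov: "covered_by c d" and z: "a \<le> z" "z \<le> b" for z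
  proof -
    have "sup c z = c \<or> sup c z = d"
      using z ab by (intro covered_byD[OF cov]) (auto intro: le_supI1)
    moreover have "z = inf b (sup z c)"
      using modular_inf_sup[of z b c] z ab by (simp add: sup_absorb1)
    ultimately show ?thesis using ab by (metis sup_commute inf_sup_absorb inf_commute)
  qed
  have "a = b \<longleftrightarrow> c = d" using ab by (metis inf_le2 inf_sup_absorb sup.absorb2 sup_ge1 inf.absorb1)
  then show ?thesis
    using up down ab unfolding covered_by_def by (metis less_le)
qed

lemma projective_sym: "projective p q \<Longrightarrow> projective q p"
  unfolding projective_def
proof (induction rule: tranclp_induct)
  case (base q)
  then show ?case by (auto simp: symclp_def)
next
  case (step q r)
  have "symclp transposes_up r q" using step.hyps by (auto simp: symclp_def)
  then show ?case using step.IH by (rule tranclp_into_tranclp2)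
qed

lemma projective_trans: "projective p q \<Longrightarrow> projective q r \<Longrightarrow> projective p r"
  unfolding projective_def by (rule tranclp_trans)

lemma transposes_up_projective: "transposes_up p q \<Longrightarrow> projective p q"
  unfolding projective_def by (simp add: symclp_def tranclp.r_into_trancl)

text \<open>The modular law turns \<open>inf q (sup p t)\<close> into
  \<open>sup p (inf q t)\<close>, which is \<open>p\<close>.\<close>

lemma transposes_up_sup:
  fixes p q :: "'a::modular_lattice"
  assumes "p \<le> q" "inf q t \<le> p"
  shows "transposes_up (p, q) (sup p t, sup q t)"
  using assms modular_inf_sup[of p q t]
  by (auto simp: transposes_up_pair sup_absorb1 sup_absorb2 le_supI1 sup.left_commute intro: le_supI1)

text \<open>As nothing lies strictly between \<open>p\<close> and \<open>q\<close>, any element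
  below \<open>q\<close> but not below \<open>p\<close> joins with \<open>p\<close> to
  \<open>q\<close>.\<close>

lemma transposes_up_inf:
  fixes p q :: "'a::lattice"
  assumes "covered_by p q" "\<not> inf q t \<le> p"
  shows "transposes_up (inf p t, inf q t) (p, q)"
proof -
  have "sup p (inf q t) = q" using assms by (intro covered_by_sup_eq) auto
  moreover have "inf (inf q t) p = inf p t"
    using covered_by_le[OF assms(1)] by (metis inf.absorb1 inf.assoc inf.commute)
  ultimately show ?thesis using covered_by_le[OF assms(1)]
    by (auto simp: transposes_up_pair sup_commute intro: le_infI1)
qed

section \<open>Linked coverings\<close>

definition linked :: "'a::lattice \<times> 'a \<Rightarrow> 'a \<times> 'a \<Rightarrow> bool" where
  "linked c d \<longleftrightarrow> inf (snd c) (fst d) \<le> fst c \<and> inf (snd d) (fst c) \<le> fst d \<and>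
     \<not> inf (snd c) (snd d) \<le> fst c"

text \<open>If the remaining condition \<open>inf q u \<le> p\<close> failed, \<open>q\<close> would
  be the join of \<open>inf q u\<close> and \<open>p\<close>, and the modular law would split
  \<open>inf v q\<close> into two parts below \<open>u\<close>.\<close>

lemma linkedI:
  fixes u v p q :: "'a::modular_lattice"
  assumes "u \<le> v" "covered_by p q" "inf v p \<le> u" "\<not> inf v q \<le> u"
  shows "linked (u, v) (p, q)"
proof -
  have "inf q u \<le> p"
  proof (rule ccontr)
    assume "\<not> inf q u \<le> p"
    then have "sup p (inf q u) = q" using assms(2) by (intro covered_by_sup_eq) auto
    then have "inf v q = inf v (sup (inf q u) p)" by (simp add: sup_commute)
    also have "\<dots> = sup (inf q u) (inf v p)"
      using assms(1) by (intro modular_inf_sup) (rule le_infI2)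
    also have "\<dots> \<le> u" using assms(3) by simp
    finally show False using assms(4) by simp
  qed
  then show ?thesis using assms by (simp add: linked_def)
qed

lemma linked_sym:
  assumes "linked c d"
  shows "linked d c"
proof -
  have "inf (snd c) (snd d) \<le> fst c" if "inf (snd d) (snd c) \<le> fst d"
  proof -
    have "inf (snd c) (snd d) \<le> inf (snd c) (fst d)"
      using that by (simp add: inf_commute)
    also have "\<dots> \<le> fst c" using assms by (simp add: linked_def)
    finally show ?thesis .
  qed
  then show ?thesis using assms by (auto simp: linked_def)
qed

text \<open>Both coverings are upper transposes of one pair, \<open>(inf u q, inf v q)\<close>; its
  lower end is symmetric because \<open>inf u q = inf p v\<close>.\<close>

lemma linked_projective:
  fixes u v p q :: "'a::lattice"
  assumes "linked (u, v) (p, q)" "covered_by u v" "covered_by p q"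
  shows "projective (u, v) (p, q)"
proof -
  have l: "inf v p \<le> u" "inf q u \<le> p" "\<not> inf v q \<le> u" "\<not> inf q v \<le> p"
    using assms(1) linked_sym[OF assms(1)] by (auto simp: linked_def)
  have "inf u q = inf p v" 
    using l covered_by_le[OF assms(2)] covered_by_le[OF assms(3)]
    by (intro order.antisym) (auto simp: inf_commute intro: le_infI1 le_infI2)
  then show ?thesis
    using transposes_up_inf[OF assms(2) l(3)] transposes_up_inf[OF assms(3) l(4)]
    by (metis inf_commute projective_sym projective_trans transposes_up_projective)
qed

text \<open>The elements \<open>t\<close> with \<open>inf (snd c) t \<le> fst c\<close> form a
  down-set, and a covering linked with \<open>c\<close> has its lower end inside and its upper end
  outside. A chain leaves a down-set only once.\<close>

lemma linked_unique:
  fixes u v p q :: "'a::lattice"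
  assumes "linked c (p, q)" "linked c (p', q')" "covered_by p q" "covered_by p' q'"
    and "{p, q, p', q'} \<subseteq> D" "\<And>s t. s \<in> D \<Longrightarrow> t \<in> D \<Longrightarrow> s \<le> t \<or> t \<le> s"
  shows "(p, q) = (p', q')"
proof -
  have no: "\<not> s < s'"
    if "linked c (s, t)" "linked c (s', t')" "covered_by s t" "t \<le> s' \<or> s' \<le> t" for s t s' t'
  proof
    assume "s < s'"
    then have "t \<le> s'" using that(3,4) by (metis covered_by_def order_le_imp_less_or_eq order_refl)
    then have "inf (snd c) t \<le> fst c"
      using that(2) unfolding linked_def by (metis fst_conv inf_mono order_refl order_trans)
    then show False using that(1) by (simp add: linked_def)
  qed
  have mem: "p \<in> D" "q \<in> D" "p' \<in> D" "q' \<in> D" using assms(5) by auto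
  have "\<not> p < p'" "\<not> p' < p"
    using no[OF assms(1,2,3)] no[OF assms(2,1,4)] assms(6) mem by blast+
  then have "p = p'" using assms(6)[of p p'] mem by (auto simp: le_less)
  moreover have "q = q'"
    using assms(6)[of q q'] mem assms(3,4) \<open>p = p'\<close> unfolding covered_by_def
    by (metis le_less)
  ultimately show ?thesis by simp
qed

section \<open>Equality of cardinals from matchings\<close>

lemma card_of_ordIso_relation:
  assumes "\<And>a. a \<in> A \<Longrightarrow> \<exists>b\<in>B. R a b" "\<And>b. b \<in> B \<Longrightarrow> \<exists>a\<in>A. R a b"
    and "\<And>a b b'. a \<in> A \<Longrightarrow> b \<in> B \<Longrightarrow> b' \<in> B \<Longrightarrow> R a b \<Longrightarrow> R a b' \<Longrightarrow> b = b'"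
    and "\<And>a a' b. a \<in> A \<Longrightarrow> a' \<in> A \<Longrightarrow> b \<in> B \<Longrightarrow> R a b \<Longrightarrow> R a' b \<Longrightarrow> a = a'"
  shows "|A| =o |B|"
proof -
  obtain f where f: "\<And>a. a \<in> A \<Longrightarrow> f a \<in> B \<and> R a (f a)" using assms(1) by metis
  have "inj_on f A" by (rule inj_onI) (metis assms(4) f)
  moreover have "f ` A = B" using f assms(2,3) by (auto simp: image_iff) metis
  ultimately show ?thesis using card_of_ordIso by (auto simp: bij_betw_def)
qed

lemma card_of_ordIso_linked:
  fixes A B :: "('a::lattice \<times> 'a) set"
  assumes C: "\<And>s t. s \<in> C \<Longrightarrow> t \<in> C \<Longrightarrow> s \<le> t \<or> t \<le> s"
    and D: "\<And>s t. s \<in> D \<Longrightarrow> t \<in> D \<Longrightarrow> s \<le> t \<or> t \<le> s"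
    and A: "\<And>u v. (u, v) \<in> A \<Longrightarrow> u \<in> C \<and> v \<in> C \<and> covered_by u v"
    and B: "\<And>p q. (p, q) \<in> B \<Longrightarrow> p \<in> D \<and> q \<in> D \<and> covered_by p q"
    and AB: "\<And>u v. (u, v) \<in> A \<Longrightarrow> \<exists>p q. (p, q) \<in> B \<and> linked (u, v) (p, q)"
    and BA: "\<And>p q. (p, q) \<in> B \<Longrightarrow> \<exists>u v. (u, v) \<in> A \<and> linked (p, q) (u, v)"
  shows "|A| =o |B|"
proof (rule card_of_ordIso_relation[where R = linked])
  show "\<exists>b\<in>B. linked a b" if "a \<in> A" for a
    using that AB by (cases a) blast
  show "\<exists>a\<in>A. linked a b" if "b \<in> B" for b
    using that BA linked_sym by (cases b) blast
  show "b = b'" if "b \<in> B" "b' \<in> B" "linked a b" "linked a b'" for a b b'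
  proof -
    obtain p q p' q' where "b = (p, q)" "b' = (p', q')" by (cases b, cases b') blast
    then show ?thesis
      using that B[of p q] B[of p' q'] linked_unique[of a p q p' q' D] D by simp
  qed
  show "a = a'" if "a \<in> A" "a' \<in> A" "linked a b" "linked a' b" for a a' b
  proof -
    obtain p q p' q' where "a = (p, q)" "a' = (p', q')" by (cases a, cases a') blast
    then show ?thesis
      using that(1,2) that(3,4)[THEN linked_sym] A[of p q] A[of p' q']
        linked_unique[of b p q p' q' C] C by simp
  qed
qed

section \<open>Maximal chains\<close>

lemma maximal_chain_comparable: "maximal_chain C \<Longrightarrow> s \<in> C \<Longrightarrow> t \<in> C \<Longrightarrow> s \<le> t \<or> t \<le> s"
  unfolding pred_on.maxchain_def pred_on.chain_def by (auto simp: le_less)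

lemma maximal_chain_mem:
  assumes "maximal_chain C" "\<And>c. c \<in> C \<Longrightarrow> z \<le> c \<or> c \<le> z"
  shows "z \<in> C"
proof (rule ccontr)
  assume "z \<notin> C"
  moreover have "pred_on.chain UNIV (<) (insert z C)"
    using assms unfolding pred_on.maxchain_def pred_on.chain_def by (auto simp: le_less)
  ultimately show False using assms(1) unfolding pred_on.maxchain_def by blast
qed

lemma maximal_chain_Sup:
  fixes C :: "'a::complete_lattice set"
  assumes "maximal_chain C" "A \<subseteq> C"
  shows "Sup A \<in> C"
  using assms(1)
proof (rule maximal_chain_mem)
  fix c assume "c \<in> C"
  then have "a \<le> c \<or> c \<le> a" if "a \<in> A" for a
    using maximal_chain_comparable[OF assms(1)] assms(2) that by blast
  then show "Sup A \<le> c \<or> c \<le> Sup A"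
    by (blast intro: Sup_least Sup_upper2)
qed

lemma maximal_chain_Inf:
  fixes C :: "'a::complete_lattice set"
  assumes "maximal_chain C" "A \<subseteq> C"
  shows "Inf A \<in> C"
  using assms(1)
proof (rule maximal_chain_mem)
  fix c assume "c \<in> C"
  then have "a \<le> c \<or> c \<le> a" if "a \<in> A" for a
    using maximal_chain_comparable[OF assms(1)] assms(2) that by blast
  then show "Inf A \<le> c \<or> c \<le> Inf A"
    by (blast intro: Inf_greatest Inf_lower2)
qed

text \<open>Applied both to the lattice and to its lattice of filters. The hypotheses
  \<open>S\<close> and \<open>T\<close> are what has to be proved separately in each case.\<close>

lemma maximal_chain_linked:
  fixes C :: "'a::{complete_lattice, modular_lattice} set"
  assumes C: "maximal_chain C" and pq: "covered_by p q"
    and S: "inf q (Sup {w\<in>C. inf q w \<le> p}) \<le> p"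
    and T: "\<not> inf q (Inf {w\<in>C. \<not> inf q w \<le> p}) \<le> p"
  shows "\<exists>s\<in>C. \<exists>t\<in>C. covered_by s t \<and> linked (p, q) (s, t)"
proof -
  define s where "s = Sup {w\<in>C. inf q w \<le> p}"
  define t where "t = Inf {w\<in>C. \<not> inf q w \<le> p}"
  have low: "w \<le> s" if "w \<in> C" "inf q w \<le> p" for w
    unfolding s_def using that by (intro Sup_upper) auto
  have high: "t \<le> w" if "w \<in> C" "\<not> inf q w \<le> p" for w
    unfolding t_def using that by (intro Inf_lower) auto
  have st: "s \<in> C" "t \<in> C"
    unfolding s_def t_def using C by (auto intro: maximal_chain_Sup maximal_chain_Inf)
  have nle: "inf q s \<le> p" "\<not> inf q t \<le> p" using S T by (auto simp: s_def t_def)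
  then have "\<not> t \<le> s" by (metis inf_mono order_refl order_trans)
  then have "s < t" using maximal_chain_comparable[OF C st] by auto
  \<comment> \<open>Every element of \<open>C\<close> is below \<open>s\<close> or above
    \<open>t\<close>, so such a \<open>z\<close> is comparable with all of \<open>C\<close>.
    Maximality puts it into \<open>C\<close>, hence on one of the two sides.\<close>
  have "False" if "s < z" "z < t" for z
  proof -
    have "z \<in> C"
      using C by (rule maximal_chain_mem) (metis low high that less_imp_le order_trans)
    then show False using low high that by (metis leD)
  qed
  then have cov: "covered_by s t" using \<open>s < t\<close> by (auto simp: covered_by_def)
  then show ?thesis using linkedI[OF covered_by_le[OF pq] cov nle] st by blast
qed

section \<open>Principal filters\<close>

text \<open>Membership in a filter becomes an inequality, so that filters can be handled by order
  reasoning.\<close>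

lemma le_Fg_iff: "U \<le> Fg d \<longleftrightarrow> d \<in> filter_set U"
  by transfer (auto simp: is_lattice_filter_def)

lemma lattice_filter_leI: "(\<And>d. V \<le> Fg d \<Longrightarrow> U \<le> Fg d) \<Longrightarrow> U \<le> V"
  unfolding le_Fg_iff by transfer blast

lemma Fg_le_Fg [simp]: "Fg a \<le> Fg b \<longleftrightarrow> a \<le> b"
  by transfer (auto intro: order_trans)

lemma Fg_eq_Fg [simp]: "Fg a = Fg b \<longleftrightarrow> a = b"
  by (simp add: order_eq_iff)

lemma le_Fg_mono: "U \<le> Fg a \<Longrightarrow> a \<le> b \<Longrightarrow> U \<le> Fg b"
  by (metis Fg_le_Fg order_trans)

lemma ex_le_Fg: "\<exists>a. U \<le> Fg a"
  unfolding le_Fg_iff by transfer (auto simp: is_lattice_filter_def)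

lemma ex_lattice_filter:
  assumes "is_lattice_filter F"
  shows "\<exists>G. \<forall>z. G \<le> Fg z \<longleftrightarrow> z \<in> F"
  using assms unfolding le_Fg_iff by (metis Abs_lattice_filter_inverse mem_Collect_eq)

lemma inf_le_Fg_iff:
  "inf U V \<le> Fg z \<longleftrightarrow> (\<exists>u v. U \<le> Fg u \<and> V \<le> Fg v \<and> inf u v \<le> z)"
  unfolding le_Fg_iff by transfer blast

lemma Fg_sup: "Fg (sup a b) = sup (Fg a) (Fg b)"
  by transfer auto

lemma Fg_inf: "Fg (inf a b) = inf (Fg a) (Fg b)"
proof (rule order.antisym)
  show "inf (Fg a) (Fg b) \<le> Fg (inf a b)"
    unfolding inf_le_Fg_iff by (intro exI[of _ a] exI[of _ b]) auto
qed simp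

text \<open>A filter \<open>W\<close> between the two, other than \<open>Fg b\<close>, has a member
  \<open>w\<close> not above \<open>b\<close>. Then \<open>inf b w = a\<close> by the covering, and
  this meet is again a member of \<open>W\<close>.\<close>

lemma Fg_covered_by:
  assumes "covered_by a b"
  shows "covered_by (Fg a) (Fg b)"
proof -
  have ab: "a \<le> b" "a < b" using assms by (auto simp: covered_by_le covered_by_less)
  have "W \<le> Fg a" if W: "Fg a \<le> W" "W \<le> Fg b" "\<not> Fg b \<le> W" for W
  proof -
    obtain w where w: "W \<le> Fg w" "\<not> b \<le> w"
      using lattice_filter_leI[of W "Fg b"] W(3) by auto
    have "a \<le> w" using order_trans[OF W(1) w(1)] by simp
    then have "inf b w = a" using assms w(2) by (intro covered_by_inf_le)
    moreover have "W \<le> Fg (inf b w)" using W(2) w(1) by (simp add: Fg_inf)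
    ultimately show ?thesis by simp
  qed
  moreover have "Fg a < Fg b" using ab by (simp add: less_le)
  ultimately show ?thesis unfolding covered_by_def by (meson less_le_not_le)
qed

lemma Fg_transposes_up [simp]:
  "transposes_up (Fg a, Fg b) (Fg c, Fg d) \<longleftrightarrow> transposes_up (a, b) (c, d)"
  by (simp add: transposes_up_pair Fg_inf[symmetric] Fg_sup[symmetric])

lemma Fg_projective:
  assumes "projective (a, b) (c, d)"
  shows "projective (Fg a, Fg b) (Fg c, Fg d)"
proof -
  have "projective (map_prod Fg Fg p) (map_prod Fg Fg q)" if "projective p q" for p q :: "'a \<times> 'a"
    using that unfolding projective_def
  proof (induction rule: tranclp_induct)
    case (base q)
    then show ?case by (cases p, cases q) (auto simp: symclp_def intro!: tranclp.r_into_trancl)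
  next
    case (step q r)
    have "symclp transposes_up (map_prod Fg Fg q) (map_prod Fg Fg r)"
      using step.hyps(2) by (cases q, cases r) (auto simp: symclp_def)
    with step.IH show ?case by (rule tranclp.trancl_into_trancl)
  qed
  from this[OF assms] show ?thesis by simp
qed

text \<open>With \<open>a'\<close> in \<open>U'\<close> but not in \<open>V'\<close>, and \<open>c = inf a a'\<close>, modularity makes \<open>sup (Fg c) V\<close>
  principal.\<close>

lemma principal_transpose_step:
  fixes a b :: "'a::modular_lattice"
  assumes cov: "covered_by a b" and ab: "transposes_up (U, V) (Fg a, Fg b)"
    and up: "transposes_up (U, V) (U', V')"
  shows "\<exists>a' b'. covered_by a' b' \<and> projective (a', b') (a, b) \<and> transposes_up (U', V') (Fg a', Fg b')"
proof -
  have "covered_by U V" using transposes_up_covered_by[OF ab] Fg_covered_by[OF cov] by simp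
  then have cov': "covered_by U' V'" using transposes_up_covered_by[OF up] by simp
  then have "\<not> V' \<le> U'" using covered_by_less by (metis leD)
  then obtain a' where a': "U' \<le> Fg a'" "\<not> V' \<le> Fg a'"
    using lattice_filter_leI[of U' V'] by blast
  have "inf V' (Fg a') = U'" using cov' a' by (rule covered_by_inf_le)
  \<comment> \<open>It remains to show that the upper end of the new pair is principal.\<close>
  then have t': "transposes_up (U', V') (Fg a', sup V' (Fg a'))"
    using covered_by_le[OF cov'] by (simp add: transposes_up_pair)
  have t: "inf V (Fg a') = U" "sup V (Fg a') = sup V' (Fg a')"
    using transposes_up_trans[OF up t'] by (auto simp: transposes_up_pair)
  have UV: "inf V (Fg a) = U" "sup V (Fg a) = Fg b" "U \<le> V" "a \<le> b"
    using ab by (auto simp: transposes_up_pair)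
  define c where "c = inf a a'"
  have Uc: "U \<le> Fg c"
    using UV(1) t(1) by (metis c_def Fg_inf inf.boundedI inf_le2)
  define X where "X = sup (Fg c) V"
  have Xinf: "inf (Fg e) X = Fg c" if "c \<le> e" "inf V (Fg e) = U" for e
  proof -
    have "inf (Fg e) X = sup (Fg c) (inf (Fg e) V)"
      unfolding X_def using that by (intro modular_inf_sup) simp
    then show ?thesis using that Uc by (simp add: inf_commute sup_absorb1)
  qed
  have Xa: "inf (Fg a) X = Fg c" using UV(1) by (intro Xinf) (simp_all add: c_def)
  have Xa': "inf (Fg a') X = Fg c" using t(1) by (intro Xinf) (simp_all add: c_def)
  have Vb: "V \<le> Fg b" using UV(2) by (metis sup_ge1)
  then have Xb: "X \<le> Fg b" using UV(4) by (auto simp: X_def c_def intro: le_infI1)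
  \<comment> \<open>A member of \<open>X\<close> witnessing \<open>inf (Fg a) X \<le> Fg c\<close>,
    cut down by \<open>b\<close>, which is also a member of \<open>X\<close>.\<close>
  obtain z where z: "X \<le> Fg z" "inf a z \<le> c" "z \<le> b"
  proof -
    obtain e z where ez: "a \<le> e" "X \<le> Fg z" "inf e z \<le> c"
      using Xa inf_le_Fg_iff[of "Fg a" X c] by auto
    then have "X \<le> Fg (inf z b)" using Xb by (simp add: Fg_inf)
    moreover have "inf a (inf z b) \<le> inf e z" using ez(1) by (intro inf_mono) auto
    then have "inf a (inf z b) \<le> c" using ez(3) by (rule order_trans)
    ultimately show ?thesis using that inf_le2 by blast
  qed
  have cz: "c \<le> z" using order_trans[of "Fg c" X "Fg z"] z(1) by (simp add: X_def)
  have "Fg b \<le> Fg (sup z a)"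
    unfolding UV(2)[symmetric] Fg_sup using z(1) by (auto simp: X_def intro: le_supI1)
  then have "sup z a = b" using z(3) UV(4) by (simp add: order_eq_iff)
  then have tcz: "transposes_up (c, z) (a, b)"
    using cz z(2) UV(4) by (auto simp: transposes_up_pair inf_commute c_def intro: order.antisym)
  then have covcz: "covered_by c z" using transposes_up_covered_by cov by blast
  have "X \<noteq> Fg c"
  proof
    assume "X = Fg c"
    then have "V \<le> Fg c" by (metis X_def sup_ge2)
    then have "V \<le> Fg a" by (rule le_Fg_mono) (simp add: c_def)
    then show False using UV(2) cov covered_by_less by (auto simp: sup_absorb2)
  qed
  then have X: "X = Fg z"
    using covered_byD[OF Fg_covered_by[OF covcz] _ z(1)] by (auto simp: X_def)
  have "sup V' (Fg a') = sup X (Fg a')"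
    unfolding t(2)[symmetric] X_def
    by (rule order.antisym) (auto simp: c_def intro: le_supI1 le_supI2)
  then have W: "sup V' (Fg a') = Fg (sup z a')" by (simp add: X Fg_sup)
  have "inf a' z = c" using Xa' by (simp add: X Fg_inf[symmetric])
  then have tcz': "transposes_up (c, z) (a', sup z a')"
    using cz by (simp add: transposes_up_pair inf_commute)
  have "projective (a', sup z a') (a, b)"
    using transposes_up_projective[OF tcz'] transposes_up_projective[OF tcz]
    by (blast intro: projective_sym projective_trans)
  moreover have "covered_by a' (sup z a')" using transposes_up_covered_by[OF tcz'] covcz by simp
  moreover have "transposes_up (U', V') (Fg a', Fg (sup z a'))" using t' by (simp only: W)
  ultimately show ?thesis by blast
qed

text \<open>Induction along the sequence of transposes, starting from its end
  \<open>(Fg x, Fg y)\<close>. Upward steps compose by transitivity; downward ones are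
  \<open>principal_transpose_step\<close>.\<close>

lemma projective_Fg_transposes_up:
  fixes x y :: "'a::modular_lattice"
  assumes xy: "covered_by x y" and UV: "projective (U, V) (Fg x, Fg y)"
  shows "\<exists>a b. covered_by a b \<and> projective (a, b) (x, y) \<and> transposes_up (U, V) (Fg a, Fg b)"
proof -
  define P where
    "P r \<longleftrightarrow> (\<exists>a b. covered_by a b \<and> projective (a, b) (x, y) \<and> transposes_up r (Fg a, Fg b))" for r
  have step: "P r" if rs: "symclp transposes_up r s" and s: "P s" for r s
  proof -
    obtain a b where ab: "covered_by a b" "projective (a, b) (x, y)" "transposes_up s (Fg a, Fg b)"
      using s unfolding P_def by blast
    consider "transposes_up r s" | "transposes_up s r" using rs by (auto simp: symclp_def)
    then show ?thesis
    proof cases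
      case 1
      then show ?thesis using ab transposes_up_trans unfolding P_def by blast
    next
      case 2
      obtain a' b' where "covered_by a' b'" "projective (a', b') (a, b)" "transposes_up r (Fg a', Fg b')"
        using principal_transpose_step[of a b "fst s" "snd s" "fst r" "snd r"] ab 2 by auto
      then show ?thesis using projective_trans[OF _ ab(2)] unfolding P_def by blast
    qed
  qed
  have refl: "transposes_up (x, y) (x, y)"
    using covered_by_le[OF xy] by (simp add: transposes_up_pair inf_absorb2 sup_absorb1)
  then have "transposes_up (Fg x, Fg y) (Fg x, Fg y)" by simp
  then have base: "P (Fg x, Fg y)"
    using xy transposes_up_projective[OF refl] unfolding P_def by blast
  have "P (U, V)"
    using UV unfolding projective_def
    by (induction rule: converse_tranclp_induct) (blast intro: step base)+
  then show ?thesis by (simp only: P_def)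
qed

text \<open>Under reverse inclusion the infimum of a nonempty chain of filters is their union, since
  that union is a filter.\<close>

lemma Inf_le_Fg_chain:
  fixes \<W> :: "'a::bounded_lattice_top lattice_filter set"
  assumes chain: "\<And>V W. V \<in> \<W> \<Longrightarrow> W \<in> \<W> \<Longrightarrow> V \<le> W \<or> W \<le> V"
    and ne: "\<W> \<noteq> {}" and z: "Inf \<W> \<le> Fg z"
  shows "\<exists>W\<in>\<W>. W \<le> Fg z"
proof -
  have "is_lattice_filter {z. \<exists>W\<in>\<W>. W \<le> Fg z}"
    unfolding is_lattice_filter_def
  proof (intro conjI allI impI ballI)
    show "{z. \<exists>W\<in>\<W>. W \<le> Fg z} \<noteq> {}" using ne ex_le_Fg by auto
    show "b \<in> {z. \<exists>W\<in>\<W>. W \<le> Fg z}" if "a \<in> {z. \<exists>W\<in>\<W>. W \<le> Fg z}" "a \<le> b" for a b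
      using that le_Fg_mono by blast
    show "inf a b \<in> {z. \<exists>W\<in>\<W>. W \<le> Fg z}"
      if ab: "a \<in> {z. \<exists>W\<in>\<W>. W \<le> Fg z}" "b \<in> {z. \<exists>W\<in>\<W>. W \<le> Fg z}" for a b
    proof -
      obtain V W where "V \<in> \<W>" "V \<le> Fg a" "W \<in> \<W>" "W \<le> Fg b" using ab by blast
      then obtain W where "W \<in> \<W>" "W \<le> Fg a" "W \<le> Fg b" using chain order_trans by metis
      then show ?thesis by (auto simp: Fg_inf)
    qed
  qed
  from ex_lattice_filter[OF this]
  obtain G where G: "\<And>z. G \<le> Fg z \<longleftrightarrow> (\<exists>W\<in>\<W>. W \<le> Fg z)" by auto
  have "G \<le> W" if "W \<in> \<W>" for W
    by (rule lattice_filter_leI) (use that in \<open>auto simp only: G\<close>)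
  then have "G \<le> Inf \<W>" by (rule Inf_greatest)
  then have "G \<le> Fg z" using z by (rule order_trans)
  then show ?thesis by (simp only: G)
qed

section \<open>Regularity as a condition on chains and directed sets\<close>

text \<open>The regularity conditions index families by pairs, so a chain \<open>T\<close> of
  elements enters as its diagonal.\<close>

lemma linear_order_on_diagonal:
  fixes T :: "'a::order set"
  assumes "\<And>s t. s \<in> T \<Longrightarrow> t \<in> T \<Longrightarrow> s \<le> t \<or> t \<le> s"
  shows "linear_order_on ((\<lambda>t. (t, t)) ` T) {((s, s), (t, t)) |s t. s \<in> T \<and> t \<in> T \<and> s \<le> t}"
    (is "linear_order_on ?I ?r")
proof -
  have "trans ?r" by (rule transI) (auto intro: order_trans)
  moreover have "antisym ?r" by (rule antisymI) auto
  moreover have "total_on ?I ?r" using assms by (auto simp: total_on_def)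
  moreover have "refl_on ?I ?r" "?r \<subseteq> ?I \<times> ?I" by (auto simp: refl_on_def)
  ultimately show ?thesis
    by (simp add: linear_order_on_def partial_order_on_def preorder_on_def)
qed

text \<open>The hypothesis includes \<open>T = {}\<close>, which provides an element satisfying
  \<open>P\<close>.\<close>

lemma Zorn_maximal:
  fixes P :: "'a::order \<Rightarrow> bool"
  assumes "\<And>T. \<lbrakk>\<And>s t. s \<in> T \<Longrightarrow> t \<in> T \<Longrightarrow> s \<le> t \<or> t \<le> s; \<And>t. t \<in> T \<Longrightarrow> P t\<rbrakk> \<Longrightarrow> \<exists>u. P u \<and> (\<forall>t\<in>T. t \<le> u)"
  obtains m where "P m" "\<And>z. P z \<Longrightarrow> m \<le> z \<Longrightarrow> z = m"
proof -
  have "\<exists>m\<in>Collect P. \<forall>a\<in>Collect P. m \<le> a \<longrightarrow> a = m"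
  proof (rule predicate_Zorn)
    show "partial_order_on (Collect P) (relation_of (\<le>) (Collect P))"
      by (rule partial_order_on_relation_ofI) auto
    fix T assume "T \<in> Chains (relation_of (\<le>) (Collect P))"
    then have "s \<le> t \<or> t \<le> s" "P s" if "s \<in> T" "t \<in> T" for s t
      using that by (auto simp: Chains_def relation_of_def)
    then show "\<exists>u\<in>Collect P. \<forall>a\<in>T. a \<le> u" using assms[of T] by blast
  qed
  then show ?thesis using that by blast
qed

lemma Zorn_minimal:
  fixes P :: "'a::order \<Rightarrow> bool"
  assumes "\<And>T. \<lbrakk>\<And>s t. s \<in> T \<Longrightarrow> t \<in> T \<Longrightarrow> s \<le> t \<or> t \<le> s; \<And>t. t \<in> T \<Longrightarrow> P t\<rbrakk> \<Longrightarrow> \<exists>u. P u \<and> (\<forall>t\<in>T. u \<le> t)"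
  obtains m where "P m" "\<And>z. P z \<Longrightarrow> z \<le> m \<Longrightarrow> z = m"
proof -
  have "\<exists>m\<in>Collect P. \<forall>a\<in>Collect P. m \<ge> a \<longrightarrow> a = m"
  proof (rule predicate_Zorn)
    show "partial_order_on (Collect P) (relation_of (\<ge>) (Collect P))"
      by (rule partial_order_on_relation_ofI) auto
    fix T assume "T \<in> Chains (relation_of (\<ge>) (Collect P))"
    then have "s \<le> t \<or> t \<le> s" "P s" if "s \<in> T" "t \<in> T" for s t
      using that by (auto simp: Chains_def relation_of_def)
    then show "\<exists>u\<in>Collect P. \<forall>a\<in>T. a \<ge> u" using assms[of T] by blast
  qed
  then show ?thesis using that by blast
qed

lemma upper_regularD:
  fixes x y :: "'a::complete_lattice" and I :: "('a \<times> 'a) set"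
  assumes "upper_regular x y" "I \<noteq> {}" "linear_order_on I r"
    and "\<And>i. i \<in> I \<Longrightarrow> covered_by (X i) (Y i) \<and> projective (X i, Y i) (x, y)"
    and "\<And>i j. (i, j) \<in> r \<Longrightarrow> transposes_up (X i, Y i) (X j, Y j)"
  shows "covered_by (SUP i\<in>I. X i) (SUP i\<in>I. Y i)"
  using assms(1) unfolding upper_regular_def
  apply (elim conjE)
  apply (erule allE[of _ I], erule allE[of _ r], erule allE[of _ X], erule allE[of _ Y])
  using assms(2-) by blast

lemma lower_regularD:
  fixes x y :: "'a::complete_lattice" and I :: "('a \<times> 'a) set"
  assumes "lower_regular x y" "I \<noteq> {}" "linear_order_on I r"
    and "\<And>i. i \<in> I \<Longrightarrow> covered_by (X i) (Y i) \<and> projective (X i, Y i) (x, y)"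
    and "\<And>i j. (i, j) \<in> r \<Longrightarrow> transposes_up (X j, Y j) (X i, Y i)"
  shows "covered_by (INF i\<in>I. X i) (INF i\<in>I. Y i)"
  using assms(1) unfolding lower_regular_def
  apply (elim conjE)
  apply (erule allE[of _ I], erule allE[of _ r], erule allE[of _ X], erule allE[of _ Y])
  using assms(2-) by blast

locale regular_covering =
  fixes x y :: "'a::{complete_lattice, modular_lattice}"
  assumes regular: "regular x y"
begin

definition cov :: "'a \<Rightarrow> 'a \<Rightarrow> bool" where
  "cov p q \<longleftrightarrow> covered_by p q \<and> projective (p, q) (x, y)"

lemma cov_transposes_up:
  assumes "cov p q" "transposes_up (p, q) (r, s) \<or> transposes_up (r, s) (p, q)"
  shows "cov r s"
  using assms transposes_up_covered_by transposes_up_projective projective_sym projective_trans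
  unfolding cov_def by metis

text \<open>The coverings \<open>(sup p t, sup q t)\<close> grow by transposition along
  \<open>T\<close>, so upper regularity keeps their suprema apart. If the conclusion failed,
  \<open>q\<close> would lie below \<open>sup p (Sup T)\<close> and the two suprema would
  coincide.\<close>

lemma inf_Sup_le:
  assumes pq: "cov p q" and chain: "\<And>s t. s \<in> T \<Longrightarrow> t \<in> T \<Longrightarrow> s \<le> t \<or> t \<le> s"
    and le: "\<And>t. t \<in> T \<Longrightarrow> inf q t \<le> p"
  shows "inf q (Sup T) \<le> p"
proof (cases "T = {}")
  case False
  let ?I = "(\<lambda>t. (t, t)) ` T" and ?r = "{((s, s), (t, t)) |s t. s \<in> T \<and> t \<in> T \<and> s \<le> t}"
  have c: "covered_by p q" and pl: "p \<le> q" using pq covered_by_le by (auto simp: cov_def)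
  have lin: "linear_order_on ?I ?r"
    by (rule linear_order_on_diagonal[OF chain])
  have "transposes_up (sup p s, sup q s) (sup p t, sup q t)" if "s \<in> T" "t \<in> T" "s \<le> t" for s t
  proof -
    have "inf (sup s q) (sup p t) = sup s (inf q (sup p t))"
      using that by (intro modular[symmetric]) (rule le_supI2)
    also have "inf q (sup p t) = p"
      using modular_inf_sup[OF pl, of t] le[OF that(2)] by (simp add: sup_absorb1)
    finally have "inf (sup q s) (sup p t) = sup p s" by (simp add: sup_commute)
    moreover have "sup (sup q s) (sup p t) = sup q t"
      using pl that(3) by (metis sup.absorb2 sup.assoc sup.commute)
    ultimately show ?thesis using pl by (simp add: transposes_up_pair le_supI1)
  qed
  moreover have "cov (sup p t) (sup q t)" if "t \<in> T" for t
    using cov_transposes_up[OF pq] transposes_up_sup[OF pl le[OF that]] by blast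
  ultimately have "covered_by (SUP i\<in>?I. sup p (fst i)) (SUP i\<in>?I. sup q (fst i))"
    using regular False
    by (intro upper_regularD[OF _ _ lin]) (auto simp: cov_def regular_def)
  then have less: "(SUP t\<in>T. sup p t) < (SUP t\<in>T. sup q t)"
    by (simp add: image_image covered_by_less)
  show ?thesis
  proof (rule ccontr)
    assume "\<not> ?thesis"
    then have "sup p (inf q (Sup T)) = q" using c by (intro covered_by_sup_eq) auto
    then have "q \<le> sup p (Sup T)" by (metis inf_le2 order_refl sup_mono)
    also have "sup p (Sup T) \<le> (SUP t\<in>T. sup p t)"
    proof -
      have t: "p \<le> (SUP t\<in>T. sup p t)" "t \<le> (SUP t\<in>T. sup p t)" if "t \<in> T" for t
        using SUP_upper[OF that, of "sup p"] by simp_all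
      then show ?thesis using False by (auto intro: Sup_least)
    qed
    finally have q: "q \<le> (SUP t\<in>T. sup p t)" .
    have "(SUP t\<in>T. sup q t) \<le> (SUP t\<in>T. sup p t)"
    proof (rule SUP_least)
      fix t assume "t \<in> T"
      then show "sup q t \<le> (SUP t\<in>T. sup p t)"
        using q SUP_upper[of t T "sup p"] by simp
    qed
    then show False using less by simp
  qed
qed simp

text \<open>Dually, lower regularity keeps the infima of the \<open>inf p t\<close> and of the
  \<open>inf q t\<close> apart, while \<open>inf q (Inf T) \<le> p\<close> would make them
  equal.\<close>

lemma not_inf_Inf_le:
  assumes pq: "cov p q" and chain: "\<And>s t. s \<in> T \<Longrightarrow> t \<in> T \<Longrightarrow> s \<le> t \<or> t \<le> s"
    and nle: "\<And>t. t \<in> T \<Longrightarrow> \<not> inf q t \<le> p"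
  shows "\<not> inf q (Inf T) \<le> p"
proof (cases "T = {}")
  case True
  then show ?thesis using pq covered_by_less[of p q] by (auto simp: cov_def)
next
  case False
  \<comment> \<open>Indices are ordered oppositely to \<open>T\<close>, because
    \<open>lower_regular\<close> wants the coverings to descend as the index grows.\<close>
  let ?I = "(\<lambda>t. (t, t)) ` T" and ?r = "{((t, t), (s, s)) |s t. s \<in> T \<and> t \<in> T \<and> s \<le> t}"
  have c: "covered_by p q" and pl: "p \<le> q" using pq covered_by_le by (auto simp: cov_def)
  have lin: "linear_order_on ?I ?r"
  proof -
    have "?r = {((s, s), (t, t)) |s t. s \<in> T \<and> t \<in> T \<and> s \<le> t}\<inverse>" by auto
    then show ?thesis using linear_order_on_diagonal[OF chain] by simp
  qed
  have ct: "cov (inf p t) (inf q t)" if "t \<in> T" for t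
    using cov_transposes_up[OF pq] transposes_up_inf[OF c nle[OF that]] by blast
  have "transposes_up (inf p s, inf q s) (inf p t, inf q t)" if "s \<in> T" "t \<in> T" "s \<le> t" for s t
  proof -
    have ts: "inf t s = s" using that by (simp add: inf_absorb2)
    have "\<not> inf (inf q t) s \<le> inf p t"
      using nle[OF that(1)] by (simp add: inf_assoc ts)
    then show ?thesis
      using transposes_up_inf[of "inf p t" "inf q t" s] ct[OF that(2)]
      by (simp add: inf_assoc ts cov_def)
  qed
  then have "covered_by (INF i\<in>?I. inf p (fst i)) (INF i\<in>?I. inf q (fst i))"
    using regular False ct
    by (intro lower_regularD[OF _ _ lin]) (auto simp: cov_def regular_def)
  then have less: "(INF t\<in>T. inf p t) < (INF t\<in>T. inf q t)"
    by (simp add: image_image covered_by_less)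
  show ?thesis
  proof
    assume le: "inf q (Inf T) \<le> p"
    have t: "(INF t\<in>T. inf q t) \<le> q" "(INF t\<in>T. inf q t) \<le> t" if "t \<in> T" for t
      using INF_lower[OF that, of "inf q"] by simp_all
    then have "(INF t\<in>T. inf q t) \<le> inf q (Inf T)"
      using False by (auto intro: Inf_greatest)
    then have "(INF t\<in>T. inf q t) \<le> p" using le by (rule order_trans)
    then have "(INF t\<in>T. inf q t) \<le> (INF t\<in>T. inf p t)"
      using t by (auto intro!: INF_greatest)
    then show False using less by simp
  qed
qed

text \<open>An element \<open>t\<close> that is minimal subject to \<open>\<not> inf q (inf w t) \<le> p\<close> for all \<open>w \<in> W\<close>
  is a lower bound of \<open>W\<close>.\<close>

lemma not_inf_Inf_le_directed:
  assumes pq: "cov p q" and dir: "\<And>v w. v \<in> W \<Longrightarrow> w \<in> W \<Longrightarrow> \<exists>u\<in>W. u \<le> v \<and> u \<le> w"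
    and nle: "\<And>w. w \<in> W \<Longrightarrow> \<not> inf q w \<le> p"
  shows "\<not> inf q (Inf W) \<le> p"
proof (cases "W = {}")
  case True
  then show ?thesis using pq covered_by_less[of p q] by (auto simp: cov_def)
next
  case False
  obtain t where t: "\<And>w. w \<in> W \<Longrightarrow> \<not> inf q (inf w t) \<le> p"
    and min: "\<And>z. \<forall>w\<in>W. \<not> inf q (inf w z) \<le> p \<Longrightarrow> z \<le> t \<Longrightarrow> z = t"
  proof (rule Zorn_minimal[of "\<lambda>t. \<forall>w\<in>W. \<not> inf q (inf w t) \<le> p"])
    fix T assume T: "\<And>s t. s \<in> T \<Longrightarrow> t \<in> T \<Longrightarrow> s \<le> t \<or> t \<le> s"
      and n: "\<And>t. t \<in> T \<Longrightarrow> \<forall>w\<in>W. \<not> inf q (inf w t) \<le> p"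
    have "\<not> inf q (inf w (Inf T)) \<le> p" if w: "w \<in> W" for w
    proof (cases "T = {}")
      case True
      then show ?thesis using nle[OF w] by simp
    next
      case False
      have "\<not> inf q (Inf (inf w ` T)) \<le> p"
        using pq
      proof (rule not_inf_Inf_le)
        show "r \<le> s \<or> s \<le> r" if "r \<in> inf w ` T" "s \<in> inf w ` T" for r s
          using that T by (auto intro: inf_mono)
      qed (use n w in auto)
      moreover have "Inf (inf w ` T) \<le> inf w (Inf T)"
        using False by (auto intro!: Inf_greatest intro: INF_lower2)
      ultimately show ?thesis by (metis inf_mono order_refl order_trans)
    qed
    then show "\<exists>u. (\<forall>w\<in>W. \<not> inf q (inf w u) \<le> p) \<and> (\<forall>t\<in>T. u \<le> t)"
      by (intro exI[of _ "Inf T"]) (auto intro: Inf_lower)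
  qed blast
  have "t \<le> w" if w: "w \<in> W" for w
  proof -
    \<comment> \<open>By directedness \<open>inf w t\<close> satisfies the condition defining
      \<open>t\<close>, so minimality yields \<open>inf w t = t\<close>.\<close>
    have "\<not> inf q (inf v (inf w t)) \<le> p" if "v \<in> W" for v
    proof -
      obtain u where "u \<in> W" "u \<le> v" "u \<le> w" using dir[OF \<open>v \<in> W\<close> w] by blast
      then have "inf q (inf u t) \<le> inf q (inf v (inf w t))"
        by (auto intro: le_infI1 le_infI2)
      then show ?thesis using t[OF \<open>u \<in> W\<close>] by (metis order_trans)
    qed
    then have "inf w t = t" by (intro min) auto
    then show ?thesis by (metis inf_le1)
  qed
  then have "t \<le> Inf W" by (rule Inf_greatest)
  obtain w where "w \<in> W" using False by blast
  have "inf q (inf w t) \<le> inf q (Inf W)"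
    using \<open>t \<le> Inf W\<close> by (auto intro: le_infI2)
  then show ?thesis using t[OF \<open>w \<in> W\<close>] by (metis order_trans)
qed

section \<open>Matching two maximal chains of the lattice\<close>

lemma ex_linked:
  assumes C: "maximal_chain C" and pq: "cov p q"
  shows "\<exists>s\<in>C. \<exists>t\<in>C. cov s t \<and> linked (p, q) (s, t)"
proof -
  have c: "covered_by p q" using pq by (simp add: cov_def)
  have "\<exists>s\<in>C. \<exists>t\<in>C. covered_by s t \<and> linked (p, q) (s, t)"
    using C c
  proof (rule maximal_chain_linked)
    show "inf q (Sup {w\<in>C. inf q w \<le> p}) \<le> p"
      using pq by (rule inf_Sup_le) (auto dest: maximal_chain_comparable[OF C])
    show "\<not> inf q (Inf {w\<in>C. \<not> inf q w \<le> p}) \<le> p"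
      using pq by (rule not_inf_Inf_le) (auto dest: maximal_chain_comparable[OF C])
  qed
  then show ?thesis using c pq unfolding cov_def
    by (metis linked_projective projective_sym projective_trans)
qed

lemma chain_multiplicity_ordIso:
  assumes C: "maximal_chain C" and D: "maximal_chain D"
  shows "chain_multiplicity C x y =o chain_multiplicity D x y"
  unfolding chain_multiplicity_def
proof (rule card_of_ordIso_linked[where C = C and D = D])
  show "\<exists>s t. (s, t) \<in> {(u, v). u \<in> D \<and> v \<in> D \<and> covered_by u v \<and> projective (u, v) (x, y)} \<and>
      linked (p, q) (s, t)"
    if "(p, q) \<in> {(u, v). u \<in> C \<and> v \<in> C \<and> covered_by u v \<and> projective (u, v) (x, y)}" for p q
    using that ex_linked[OF D, of p q] unfolding cov_def by blast
  show "\<exists>s t. (s, t) \<in> {(u, v). u \<in> C \<and> v \<in> C \<and> covered_by u v \<and> projective (u, v) (x, y)} \<and>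
      linked (p, q) (s, t)"
    if "(p, q) \<in> {(u, v). u \<in> D \<and> v \<in> D \<and> covered_by u v \<and> projective (u, v) (x, y)}" for p q
    using that ex_linked[OF C, of p q] unfolding cov_def by blast
qed (simp_all add: maximal_chain_comparable[OF C] maximal_chain_comparable[OF D])

section \<open>Matching between the lattice and its lattice of filters\<close>

text \<open>Comparisons of the form \<open>inf V (Fg d) \<le> U\<close> decide which principal
  covering is linked with \<open>(U, V)\<close>. Since \<open>(a, b)\<close> gives the same answers,
  a match for it in the lattice is a match for \<open>(U, V)\<close>.\<close>

lemma filter_covering_principal:
  assumes UV: "projective (U, V) (Fg x, Fg y)"
  obtains a b where "cov a b" "\<And>d. inf V (Fg d) \<le> U \<longleftrightarrow> inf b d \<le> a"
proof -
  have "covered_by x y" using regular by (simp add: regular_def upper_regular_def)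
  from projective_Fg_transposes_up[OF this UV] obtain a\<^sub>0 b\<^sub>0
    where cov0: "cov a\<^sub>0 b\<^sub>0" and t: "transposes_up (U, V) (Fg a\<^sub>0, Fg b\<^sub>0)"
    by (auto simp: cov_def)
  have c0: "covered_by a\<^sub>0 b\<^sub>0" using cov0 by (simp add: cov_def)
  have ab: "inf V (Fg a\<^sub>0) = U" "sup V (Fg a\<^sub>0) = Fg b\<^sub>0"
    using t by (auto simp: transposes_up_pair)
  have Vb: "V \<le> Fg b\<^sub>0" using ab(2) by (metis sup_ge1)
  define b where "b = Inf {v. V \<le> Fg v}"
  have b_le: "b \<le> v" if "V \<le> Fg v" for v
    unfolding b_def using that by (intro Inf_lower) simp
  \<comment> \<open>Otherwise the elements \<open>inf v d\<close>, with \<open>v\<close> a member of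
    \<open>V\<close>, form a downward directed set to which lower regularity applies. Its infimum is
    below \<open>inf b d\<close> and hence below \<open>a\<^sub>0\<close>, a contradiction.\<close>
  have key: "\<exists>v. V \<le> Fg v \<and> inf v d \<le> a\<^sub>0" if "inf b d \<le> a\<^sub>0" for d
  proof (rule ccontr)
    assume no: "\<nexists>v. V \<le> Fg v \<and> inf v d \<le> a\<^sub>0"
    let ?W = "{inf v d |v. V \<le> Fg v}"
    have "\<not> inf b\<^sub>0 (Inf ?W) \<le> a\<^sub>0"
      using cov0
    proof (rule not_inf_Inf_le_directed)
      fix r s assume "r \<in> ?W" "s \<in> ?W"
      then obtain v w where "V \<le> Fg v" "V \<le> Fg w" "r = inf v d" "s = inf w d" by blast
      then show "\<exists>u\<in>?W. u \<le> r \<and> u \<le> s"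
        by (intro bexI[of _ "inf (inf v w) d"]) (auto simp: Fg_inf intro: le_infI1)
    next
      fix r assume "r \<in> ?W"
      then obtain v where "V \<le> Fg v" "r = inf v d" by blast
      moreover have "V \<le> Fg (inf b\<^sub>0 v)" using Vb \<open>V \<le> Fg v\<close> by (simp add: Fg_inf)
      ultimately show "\<not> inf b\<^sub>0 r \<le> a\<^sub>0" using no by (auto simp: inf_assoc)
    qed
    moreover have W: "Inf ?W \<le> v" "Inf ?W \<le> d" if "V \<le> Fg v" for v
      using Inf_lower[of "inf v d" ?W] that by auto
    have "Inf ?W \<le> b" unfolding b_def by (rule Inf_greatest) (use W in blast)
    then have "Inf ?W \<le> inf b d" using W(2)[OF Vb] by simp
    then have "Inf ?W \<le> a\<^sub>0" using that by (rule order_trans)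
    ultimately show False by (simp add: le_infI2)
  qed
  have "\<not> b \<le> a\<^sub>0"
  proof
    assume "b \<le> a\<^sub>0"
    \<comment> \<open>With \<open>top\<close> for \<open>d\<close>, \<open>key\<close> produces a
      member of \<open>V\<close> below \<open>a\<^sub>0\<close>.\<close>
    then obtain v where "V \<le> Fg v" "v \<le> a\<^sub>0" using key[of top] by auto
    then have "V \<le> Fg a\<^sub>0" by (auto intro: le_Fg_mono)
    then show False using ab(2) covered_by_less[OF c0] by (simp add: sup_absorb2)
  qed
  moreover have bb: "inf b\<^sub>0 b = b" using b_le[OF Vb] by (simp add: inf_absorb2)
  ultimately have "cov (inf a\<^sub>0 b) b"
    using cov_transposes_up[OF cov0] transposes_up_inf[OF c0, of b] by metis
  moreover have "inf V (Fg d) \<le> U \<longleftrightarrow> inf b d \<le> inf a\<^sub>0 b" for d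
  proof
    assume "inf V (Fg d) \<le> U"
    then have "inf V (Fg d) \<le> Fg a\<^sub>0" using inf_le2[of V "Fg a\<^sub>0"] unfolding ab(1) by (rule order_trans)
    then obtain v e where "V \<le> Fg v" "d \<le> e" "inf v e \<le> a\<^sub>0" by (auto simp: inf_le_Fg_iff)
    moreover from this have "inf b d \<le> inf v e" by (intro inf_mono b_le)
    ultimately have "inf b d \<le> a\<^sub>0" by (blast intro: order_trans)
    then show "inf b d \<le> inf a\<^sub>0 b" by simp
  next
    assume "inf b d \<le> inf a\<^sub>0 b"
    then obtain v where "V \<le> Fg v" "inf v d \<le> a\<^sub>0" using key by auto
    then have "inf V (Fg d) \<le> Fg a\<^sub>0" by (auto simp: inf_le_Fg_iff)
    then show "inf V (Fg d) \<le> U" unfolding ab(1)[symmetric] by simp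
  qed
  ultimately show ?thesis by (rule that)
qed

lemma ex_linked_Fg:
  assumes D: "maximal_chain D" and UV: "covered_by U V" "projective (U, V) (Fg x, Fg y)"
  shows "\<exists>p\<in>D. \<exists>q\<in>D. cov p q \<and> linked (U, V) (Fg p, Fg q)"
proof -
  obtain a b where ab: "cov a b" "\<And>d. inf V (Fg d) \<le> U \<longleftrightarrow> inf b d \<le> a"
    using filter_covering_principal[OF UV(2)] by blast
  obtain p q where pq: "p \<in> D" "q \<in> D" "cov p q" "linked (a, b) (p, q)"
    using ex_linked[OF D ab(1)] by blast
  have "linked (U, V) (Fg p, Fg q)"
    using pq(3,4) by (intro linkedI covered_by_le[OF UV(1)] Fg_covered_by) (auto simp: ab(2) cov_def linked_def)
  then show ?thesis using pq by blast
qed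

text \<open>Any \<open>m\<close> that is maximal with \<open>inf q m \<le> p\<close> above the infima of the filters
  \<open>sup W (Fg p)\<close> belongs to all \<open>W\<close>: otherwise \<open>q\<close> lies below \<open>sup w m\<close> for every \<open>w\<close> of such a
  filter, and lower regularity carries this over to its infimum, which lies below \<open>m\<close>.\<close>

lemma ex_le_Fg_chain:
  assumes pq: "cov p q" and chain: "\<And>V W. V \<in> \<W> \<Longrightarrow> W \<in> \<W> \<Longrightarrow> V \<le> W \<or> W \<le> V"
    and le: "\<And>W. W \<in> \<W> \<Longrightarrow> inf (Fg q) W \<le> Fg p"
  shows "\<exists>m. inf q m \<le> p \<and> (\<forall>W\<in>\<W>. W \<le> Fg m)"
proof -
  have c: "covered_by p q" using pq by (simp add: cov_def)
  have pl: "p \<le> q" and nqp: "\<not> q \<le> p"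
    using covered_by_less[OF c] by (simp_all add: less_le_not_le)
  \<comment> \<open>The members of \<open>W\<close> above \<open>p\<close> are exactly the members
    of \<open>sup W (Fg p)\<close>.\<close>
  define a where "a W = Inf {w. p \<le> w \<and> W \<le> Fg w}" for W
  have a_le: "a W \<le> w" if "p \<le> w" "W \<le> Fg w" for w W
    unfolding a_def using that by (intro Inf_lower) simp
  have ex: "\<exists>w. p \<le> w \<and> W \<le> Fg w \<and> inf q w \<le> p" if W: "W \<in> \<W>" for W
  proof -
    obtain e w where w: "q \<le> e" "W \<le> Fg w" "inf e w \<le> p"
      using le[OF W] by (auto simp: inf_le_Fg_iff)
    then have "inf q w \<le> p" by (meson inf_mono order_refl order_trans)
    then have "inf q (sup p w) \<le> p" using modular_inf_sup[OF pl, of w] by simp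
    moreover have "W \<le> Fg (sup p w)" using w(2) by (rule le_Fg_mono) simp
    ultimately show ?thesis by (intro exI[of _ "sup p w"]) simp
  qed
  have qa: "inf q (a W) \<le> p" if W: "W \<in> \<W>" for W
  proof -
    obtain w where w: "p \<le> w" "W \<le> Fg w" "inf q w \<le> p" using ex[OF W] by blast
    have "inf q (a W) \<le> inf q w" using a_le[OF w(1,2)] by (rule inf_mono[OF order_refl])
    then show ?thesis using w(3) by (rule order_trans)
  qed
  have a_mono: "a V \<le> a W" if "V \<le> W" for V W
    unfolding a_def using that by (intro Inf_superset_mono) (auto intro: order_trans)
  have qSup: "inf q (Sup (a ` \<W>)) \<le> p"
    using pq
  proof (rule inf_Sup_le)
    show "s \<le> t \<or> t \<le> s" if "s \<in> a ` \<W>" "t \<in> a ` \<W>" for s t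
      using that chain a_mono by blast
  qed (use qa in auto)
  \<comment> \<open>Nonempty chains of candidates are bounded by their suprema because of
    \<open>inf_Sup_le\<close>; \<open>qSup\<close> deals with the empty chain.\<close>
  obtain m where m: "inf q m \<le> p" "\<And>W. W \<in> \<W> \<Longrightarrow> a W \<le> m"
    and max: "\<And>z. inf q z \<le> p \<and> (\<forall>W\<in>\<W>. a W \<le> z) \<Longrightarrow> m \<le> z \<Longrightarrow> z = m"
  proof (rule Zorn_maximal[of "\<lambda>m. inf q m \<le> p \<and> (\<forall>W\<in>\<W>. a W \<le> m)"])
    fix T assume T: "\<And>s t. s \<in> T \<Longrightarrow> t \<in> T \<Longrightarrow> s \<le> t \<or> t \<le> s"
      and P: "\<And>t. t \<in> T \<Longrightarrow> inf q t \<le> p \<and> (\<forall>W\<in>\<W>. a W \<le> t)"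
    show "\<exists>u. (inf q u \<le> p \<and> (\<forall>W\<in>\<W>. a W \<le> u)) \<and> (\<forall>t\<in>T. t \<le> u)"
    proof (cases "T = {}")
      case True
      then show ?thesis using qSup by (intro exI[of _ "Sup (a ` \<W>)"]) (auto intro: SUP_upper)
    next
      case False
      then obtain t where "t \<in> T" by blast
      have "inf q (Sup T) \<le> p" using pq T P by (intro inf_Sup_le) blast+
      moreover have "\<forall>W\<in>\<W>. a W \<le> Sup T" using P \<open>t \<in> T\<close> by (blast intro: Sup_upper2)
      ultimately show ?thesis by (blast intro: Sup_upper)
    qed
  qed blast
  have "inf q (sup p m) \<le> p" using modular_inf_sup[OF pl, of m] m(1) by simp
  then have "sup p m = m" using m(2) by (intro max) (auto intro: le_supI2)
  then have pm: "p \<le> m" by (metis sup_ge1)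
  have "W \<le> Fg m" if W: "W \<in> \<W>" for W
  proof (rule ccontr)
    assume nW: "\<not> W \<le> Fg m"
    obtain w\<^sub>0 where w0: "p \<le> w\<^sub>0" "W \<le> Fg w\<^sub>0" "inf q w\<^sub>0 \<le> p" using ex[OF W] by blast
    \<comment> \<open>No member \<open>w\<close> of \<open>W\<close> is below \<open>m\<close>, so
      \<open>sup w m\<close> is strictly larger than \<open>m\<close> and is excluded by
      maximality.\<close>
    have qw: "q \<le> sup w m" if "W \<le> Fg w" for w
    proof -
      have "\<not> w \<le> m" using le_Fg_mono[OF that] nW by blast
      then have "sup w m \<noteq> m" by (metis sup_ge1)
      then have "\<not> inf q (sup w m) \<le> p"
        using max[of "sup w m"] m(2) by (auto intro: le_supI2)
      then have "sup p (inf q (sup w m)) = q" using c by (intro covered_by_sup_eq) auto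
      then show ?thesis using pm by (metis inf_le2 le_supI le_supI2)
    qed
    have cov0: "cov w\<^sub>0 (sup q w\<^sub>0)"
      using cov_transposes_up[OF pq] transposes_up_sup[OF pl w0(3)] w0(1) by (simp add: sup_absorb2)
    let ?S = "{w. p \<le> w \<and> W \<le> Fg w \<and> w \<le> w\<^sub>0}"
    let ?W = "(\<lambda>w. inf (sup w q) m) ` ?S"
    \<comment> \<open>The contradiction is about \<open>g\<close>: lower regularity for the covering
      \<open>(w\<^sub>0, sup q w\<^sub>0)\<close> keeps it from being below
      \<open>w\<^sub>0\<close>, whereas the modular law puts it there.\<close>
    define g where "g = inf (sup q w\<^sub>0) (Inf ?W)"
    have "\<not> g \<le> w\<^sub>0"
      unfolding g_def using cov0
    proof (rule not_inf_Inf_le_directed)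
      fix r s assume "r \<in> ?W" "s \<in> ?W"
      then obtain v w where "v \<in> ?S" "w \<in> ?S" "r = inf (sup v q) m" "s = inf (sup w q) m" by blast
      moreover from this have "inf v w \<in> ?S" by (auto simp: Fg_inf intro: le_infI1)
      moreover have "inf (sup (inf v w) q) m \<le> inf (sup v q) m"
          "inf (sup (inf v w) q) m \<le> inf (sup w q) m"
        by (intro inf_mono sup_mono order_refl inf_le1 inf_le2)+
      ultimately show "\<exists>u\<in>?W. u \<le> r \<and> u \<le> s" by blast
    next
      fix r assume "r \<in> ?W"
      then obtain w where w: "p \<le> w" "W \<le> Fg w" "w \<le> w\<^sub>0" "r = inf (sup w q) m" by blast
      \<comment> \<open>By \<open>qw\<close>, joining \<open>w\<close> with \<open>r\<close> already
        yields \<open>sup w q\<close>. So \<open>r \<le> w\<^sub>0\<close> would force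
        \<open>q \<le> w\<^sub>0\<close>.\<close>
      have "sup w q = inf (sup w q) (sup w m)" using qw[OF w(2)] by (simp add: inf_absorb1)
      also have "\<dots> = sup w r" unfolding w(4) by (rule modular_inf_sup) simp
      finally have "sup w r = sup w q" by simp
      have "r \<le> sup q w\<^sub>0" using w(3,4) by (metis inf_le1 le_supI1 order_trans sup.mono sup_commute order_refl)
      show "\<not> inf (sup q w\<^sub>0) r \<le> w\<^sub>0"
      proof
        assume "inf (sup q w\<^sub>0) r \<le> w\<^sub>0"
        then have "r \<le> w\<^sub>0" using \<open>r \<le> sup q w\<^sub>0\<close> by (simp add: inf_absorb2)
        then have "sup w q \<le> w\<^sub>0" using \<open>sup w r = sup w q\<close> w(3) by (metis le_supI)
        then show False using w0(3) nqp by (simp add: inf_absorb1)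
      qed
    qed
    moreover have "g \<le> w\<^sub>0"
    proof -
      have g: "g \<le> sup w q" "g \<le> m" if "w \<in> ?S" for w
        using INF_lower[OF that, of "\<lambda>w. inf (sup w q) m"] by (auto simp: g_def intro: le_infI2)
      have "w\<^sub>0 \<in> ?S" using w0 by simp
      \<comment> \<open>The aim is \<open>h \<le> sup (a W) q\<close>: by modularity
        \<open>h\<close> is the join of \<open>q\<close> and \<open>inf h w\<^sub>0\<close>, and the
        latter is below every member of \<open>W\<close> above \<open>p\<close>.\<close>
      define h where "h = (INF w\<in>?S. sup w q)"
      have "inf h w\<^sub>0 \<le> w" if w: "p \<le> w" "W \<le> Fg w" for w
      proof -
        \<comment> \<open>Meeting with \<open>w\<^sub>0\<close> brings \<open>w\<close> into
          \<open>?S\<close>, over which \<open>h\<close> is the infimum.\<close>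
        let ?v = "inf w w\<^sub>0"
        have "?v \<in> ?S" using w w0 by (simp add: Fg_inf)
        then have "inf h w\<^sub>0 \<le> inf w\<^sub>0 (sup ?v q)"
          using INF_lower[of ?v ?S "\<lambda>w. sup w q"] by (simp add: h_def le_infI1)
        also have "\<dots> = sup ?v (inf w\<^sub>0 q)" by (rule modular_inf_sup) simp
        also have "\<dots> \<le> w" using w0(3) w(1) by (auto simp: inf_commute intro: order_trans)
        finally show ?thesis .
      qed
      then have ha: "inf h w\<^sub>0 \<le> a W" unfolding a_def by (intro Inf_greatest) simp
      have "q \<le> h" unfolding h_def by (intro INF_greatest) simp
      have "h \<le> sup w\<^sub>0 q" unfolding h_def using \<open>w\<^sub>0 \<in> ?S\<close> by (rule INF_lower)
      then have "h = inf h (sup q w\<^sub>0)" by (simp add: inf_absorb1 sup_commute)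
      also have "\<dots> = sup q (inf h w\<^sub>0)" using \<open>q \<le> h\<close> by (rule modular_inf_sup)
      also have "\<dots> \<le> sup (a W) q" using ha by (auto intro: le_supI1)
      finally have "h \<le> sup (a W) q" .
      moreover have "g \<le> h" unfolding h_def using g(1) by (intro INF_greatest)
      ultimately have "g \<le> inf m (sup (a W) q)" using g(2)[OF \<open>w\<^sub>0 \<in> ?S\<close>] by (auto intro: order_trans)
      also have "\<dots> = sup (a W) (inf m q)" using m(2)[OF W] by (rule modular_inf_sup)
      also have "\<dots> \<le> w\<^sub>0"
        using a_le[OF w0(1,2)] m(1) w0(1) by (auto simp: inf_commute intro: order_trans)
      finally show ?thesis .
    qed
    ultimately show False by simp
  qed
  then show ?thesis using m(1) by blast
qed

text \<open>For the supremum, \<open>ex_le_Fg_chain\<close> gives a common member \<open>m\<close>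
  and hence the bound \<open>Fg m\<close>. For the infimum, a witness in the union of a chain of
  filters already lies in one of them.\<close>

lemma ex_linked_filter:
  assumes C: "maximal_chain C" and pq: "cov p q"
  shows "\<exists>U\<in>C. \<exists>V\<in>C. covered_by U V \<and> projective (U, V) (Fg x, Fg y) \<and> linked (Fg p, Fg q) (U, V)"
proof -
  have c: "covered_by (Fg p) (Fg q)" and proj: "projective (Fg p, Fg q) (Fg x, Fg y)"
    using pq by (auto simp: cov_def Fg_covered_by Fg_projective)
  have "\<exists>U\<in>C. \<exists>V\<in>C. covered_by U V \<and> linked (Fg p, Fg q) (U, V)"
    using C c
  proof (rule maximal_chain_linked)
    let ?S = "{W \<in> C. inf (Fg q) W \<le> Fg p}" and ?T = "{W \<in> C. \<not> inf (Fg q) W \<le> Fg p}"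
    obtain m where m: "inf q m \<le> p" "\<And>W. W \<in> ?S \<Longrightarrow> W \<le> Fg m"
      using ex_le_Fg_chain[OF pq, of ?S] maximal_chain_comparable[OF C] by blast
    have "inf (Fg q) (Sup ?S) \<le> inf (Fg q) (Fg m)"
      using m(2) by (intro inf_mono Sup_least) auto
    also have "\<dots> \<le> Fg p" using m(1) by (simp add: Fg_inf[symmetric])
    finally show "inf (Fg q) (Sup ?S) \<le> Fg p" .
    show "\<not> inf (Fg q) (Inf ?T) \<le> Fg p"
    proof
      assume le: "inf (Fg q) (Inf ?T) \<le> Fg p"
      then obtain e z where ez: "Fg q \<le> Fg e" "Inf ?T \<le> Fg z" "inf e z \<le> p"
        unfolding inf_le_Fg_iff by blast
      have "?T \<noteq> {}"
      proof
        assume "?T = {}"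
        then have "Fg q \<le> Fg p" using le by (simp only: Inf_empty inf_top_right)
        then show False using covered_by_less[OF c] by (simp add: less_le_not_le)
      qed
      then obtain W where "W \<in> ?T" "W \<le> Fg z"
        using Inf_le_Fg_chain[of ?T z] maximal_chain_comparable[OF C] ez(2) by blast
      moreover have "inf (Fg q) W \<le> Fg p"
        unfolding inf_le_Fg_iff using ez \<open>W \<le> Fg z\<close> by blast
      ultimately show False by blast
    qed
  qed
  then show ?thesis
    using linked_projective[OF _ c] proj projective_sym projective_trans by metis
qed

lemma chain_multiplicity_Fg_ordIso:
  assumes C: "maximal_chain C" and D: "maximal_chain D"
  shows "chain_multiplicity C (Fg x) (Fg y) =o chain_multiplicity D x y"
proof -
  let ?A = "{(U, V). U \<in> C \<and> V \<in> C \<and> covered_by U V \<and> projective (U, V) (Fg x, Fg y)}"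
  let ?B = "{(p, q). p \<in> D \<and> q \<in> D \<and> covered_by p q \<and> projective (p, q) (x, y)}"
  \<comment> \<open>The coverings of \<open>D\<close> are moved into the lattice of filters. The
    image of \<open>D\<close> there is a chain but need not be maximal, so matches into it come from
    \<open>ex_linked_Fg\<close>.\<close>
  have "|?A| =o |map_prod Fg Fg ` ?B|"
  proof (rule card_of_ordIso_linked[where C = C and D = "Fg ` D"])
    show "\<exists>P Q. (P, Q) \<in> map_prod Fg Fg ` ?B \<and> linked (U, V) (P, Q)" if UV: "(U, V) \<in> ?A" for U V
    proof -
      obtain p q where pq: "p \<in> D" "q \<in> D" "cov p q" "linked (U, V) (Fg p, Fg q)"
        using ex_linked_Fg[OF D, of U V] UV by blast
      then have "(p, q) \<in> ?B" by (simp add: cov_def)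
      then have "(Fg p, Fg q) \<in> map_prod Fg Fg ` ?B" by (rule rev_image_eqI) simp
      with pq(4) show ?thesis by (intro exI conjI)
    qed
    show "\<exists>U V. (U, V) \<in> ?A \<and> linked (P, Q) (U, V)" if PQ: "(P, Q) \<in> map_prod Fg Fg ` ?B" for P Q
    proof -
      obtain p q where pq: "P = Fg p" "Q = Fg q" "cov p q" using PQ by (auto simp: cov_def)
      obtain U V where "U \<in> C" "V \<in> C" "covered_by U V" "projective (U, V) (Fg x, Fg y)"
        "linked (P, Q) (U, V)"
        using ex_linked_filter[OF C pq(3)] unfolding pq(1,2) by blast
      then show ?thesis by (intro exI[of _ U] exI[of _ V]) simp
    qed
    show "s \<le> t \<or> t \<le> s" if "s \<in> Fg ` D" "t \<in> Fg ` D" for s t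
      using that maximal_chain_comparable[OF D] by (elim imageE) simp
    show "P \<in> Fg ` D \<and> Q \<in> Fg ` D \<and> covered_by P Q" if "(P, Q) \<in> map_prod Fg Fg ` ?B" for P Q
      using that by (auto intro: Fg_covered_by)
  qed (simp_all add: maximal_chain_comparable[OF C])
  moreover have "inj_on (map_prod Fg Fg) ?B" by (auto simp: inj_on_def)
  then have "|map_prod Fg Fg ` ?B| =o |?B|"
    by (rule ordIso_symmetric[OF card_of_ordIsoI, OF inj_on_imp_bij_betw])
  ultimately show ?thesis unfolding chain_multiplicity_def by (rule ordIso_transitive)
qed

end

theorem theorem18:
  fixes x y :: "'a::{complete_lattice, modular_lattice}"
  assumes "covered_by x y" and "regular x y"
  shows "weakly_regular x y \<and> weakly_regular (Fg x) (Fg y) \<and>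
         cover_multiplicity (Fg x) (Fg y) =o cover_multiplicity x y"
proof -
  interpret regular_covering x y using assms(2) by unfold_locales
  \<comment> \<open>Polymorphic in \<open>'b\<close>, so that it serves for the lattice and for its
    filters alike.\<close>
  have ex: "maximal_chain (SOME C :: 'b::order set. maximal_chain C)"
    by (rule someI_ex) (rule pred_on.Hausdorff)
  have "weakly_regular x y"
    using assms(1) chain_multiplicity_ordIso by (simp add: weakly_regular_def)
  \<comment> \<open>Any two maximal chains of filters are compared through one maximal chain of the
    lattice.\<close>
  moreover have "weakly_regular (Fg x) (Fg y)"
    unfolding weakly_regular_def
    using Fg_covered_by[OF assms(1)] chain_multiplicity_Fg_ordIso[OF _ ex] ordIso_symmetric ordIso_transitive
    by blast
  moreover have "cover_multiplicity (Fg x) (Fg y) =o cover_multiplicity x y"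
    unfolding cover_multiplicity_def by (intro chain_multiplicity_Fg_ordIso ex)
  ultimately show ?thesis by blast
qed

end
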